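(* Let $F\in\mathbb{N}\setminus\{0\}$ and let $S\in\mathcal{A}(F)$ with $\mathcal{A}(F)_{\mathrm{rank}}(S)=1$. Then $$g(S)=F-\left\lfloor\frac{F}{m(S)}\right\rfloor.$$
   Context: Let $\mathbb{N}=\{0,1,2,\dots\}$. A numerical semigroup is a subset $S\subseteq\mathbb{N}$ that contains $0$, is closed under addition, and has finite complement $\mathbb{N}\setminus S$. Its multiplicity is $m(S)=\min(S\setminus\{0\})$, its Frobenius number is $F(S)=\max\{z\in\mathbb{Z}\mid z\notin S\}$, and its genus is $g(S)=\sharp(\mathbb{N}\setminus S)$, where $\sharp$ denotes cardinality. For $F\in\mathbb{N}\setminus\{0\}$, $\mathcal{A}(F)$ is the set of all numerical semigroups with Frobenius number $F$; its minimum with respect to inclusion is $\Delta(\mathcal{A}(F))=\{0\}\cup\{z\in\mathbb{N}\mid z\ge F+1\}$. An $\mathcal{A}(F)$-set is a subset of $M\setminus\Delta(\mathcal{A}(F))$ for some maximal (with respect to inclusion) element $M$ of $\mathcal{A}(F)$. For an $\mathcal{A}(F)$-set $A$, $\mathcal{A}(F)(A)$ denotes the intersection of all elements of $\mathcal{A}(F)$ containing $A$ (it is the least element of $\mathcal{A}(F)$ containing $A$). For $S\in\mathcal{A}(F)$, its $\mathcal{A}(F)$-rank is $\mathcal{A}(F)_{\mathrm{rank}}(S)=\min\{\sharp A\mid A\text{ is an }\mathcal{A}(F)\text{-set and }\mathcal{A}(F)(A)=S\}$. *)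

theory Defs
  imports Complex_Main
begin

definition numerical_semigroup :: "nat set \<Rightarrow> bool" where
  "numerical_semigroup S \<longleftrightarrow>
     0 \<in> S \<and> (\<forall>x\<in>S. \<forall>y\<in>S. x + y \<in> S) \<and> finite (- S)"

definition multiplicity :: "nat set \<Rightarrow> nat" where
  "multiplicity S = (LEAST n. n \<in> S - {0})"

(* The maximum ranges over the integers, so that it is -1 for S = UNIV. *)
definition frobenius_number :: "nat set \<Rightarrow> int" where
  "frobenius_number S = (GREATEST z. z \<notin> int ` S)"

definition genus :: "nat set \<Rightarrow> nat" where
  "genus S = card (- S)"

definition semigroups_frob :: "nat \<Rightarrow> nat set set" where
  "semigroups_frob F = {S. numerical_semigroup S \<and> frobenius_number S = int F}"

definition frob_min :: "nat \<Rightarrow> nat set" where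
  "frob_min F = {0} \<union> {z. z \<ge> F + 1}"

definition maximal_frob :: "nat \<Rightarrow> nat set \<Rightarrow> bool" where
  "maximal_frob F M \<longleftrightarrow>
     M \<in> semigroups_frob F \<and> (\<forall>T\<in>semigroups_frob F. M \<subseteq> T \<longrightarrow> T = M)"

definition frob_set :: "nat \<Rightarrow> nat set \<Rightarrow> bool" where
  "frob_set F A \<longleftrightarrow> (\<exists>M. maximal_frob F M \<and> A \<subseteq> M - frob_min F)"

definition frob_closure :: "nat \<Rightarrow> nat set \<Rightarrow> nat set" where
  "frob_closure F A = \<Inter> {T \<in> semigroups_frob F. A \<subseteq> T}"

(* For S in semigroups_frob F with F > 0 the least value exists:
   A = S - frob_min F is an admissible choice. Every frob_set F A is contained
   in {1..F}, so card A is its true cardinality. *)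
definition frob_rank :: "nat \<Rightarrow> nat set \<Rightarrow> nat" where
  "frob_rank F S = (LEAST k. \<exists>A. frob_set F A \<and> frob_closure F A = S \<and> card A = k)"

end

theory Submission
  imports Defs
begin

text \<open>
  Rank one means that \<open>S\<close> is the least element of \<open>\<A>(F)\<close> containing a single \<open>a\<close> with
  \<open>0 < a \<le> F\<close>, where \<open>a\<close> lies in some element of \<open>\<A>(F)\<close> and hence does not divide \<open>F\<close>. This least
  element is \<open>\<langle>a\<rangle> \<union> {F + 1, \<rightarrow>}\<close>, so \<open>m(S) = a\<close> and the gaps of \<open>S\<close> are the numbers in \<open>{1..F}\<close>
  that are not multiples of \<open>a\<close>.
\<close>

text \<open>\<open>GREATEST\<close> says something only once a maximum exists; finiteness of
  \<open>- S\<close> provides one, and it can then be compared with \<open>F\<close>.\<close>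

lemma frobenius_number_eq_iff:
  assumes "numerical_semigroup S"
  shows "frobenius_number S = int F \<longleftrightarrow> F \<notin> S \<and> {F<..} \<subseteq> S"
proof
  \<comment> \<open>The value \<open>-1\<close> keeps the set nonempty and stands for all negative
    integers, none of which lies in the image of \<open>S\<close>. So \<open>Max ?G\<close> is the
    largest integer outside \<open>S\<close>, even for \<open>S = UNIV\<close>.\<close>
  let ?G = "insert (-1) (int ` (- S))"
  have fin: "finite ?G"
    using assms by (simp add: numerical_semigroup_def)
  have non_member: "z \<notin> int ` S" if "z \<in> ?G" for z
    using that by auto
  have upper: "z \<le> Max ?G" if "z \<notin> int ` S" for z
  proof (cases "z < 0")
    case True
    then have "z \<le> -1" by simp
    also have "-1 \<le> Max ?G" using fin by (intro Max_ge) auto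
    finally show ?thesis .
  next
    case False
    then have "z = int (nat z)" by simp
    with that have "z \<in> ?G" by (metis ComplI imageI insertI2)
    then show ?thesis using fin by (intro Max_ge)
  qed
  have max_non_member: "Max ?G \<notin> int ` S"
    using fin by (intro non_member Max_in) auto
  then have greatest: "frobenius_number S = Max ?G"
    unfolding frobenius_number_def
    using upper by (rule Greatest_equality)
  assume "frobenius_number S = int F"
  then have F: "Max ?G = int F" using greatest by simp
  have "F \<notin> S" using max_non_member F by auto
  moreover have "z \<in> S" if "z > F" for z
  proof (rule ccontr)
    assume "z \<notin> S"
    then have "int z \<notin> int ` S" by auto
    then show False using upper[of "int z"] F that by linarith
  qed
  ultimately show "F \<notin> S \<and> {F<..} \<subseteq> S" by auto
next
  assume S: "F \<notin> S \<and> {F<..} \<subseteq> S"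
  show "frobenius_number S = int F"
    unfolding frobenius_number_def
  proof (rule Greatest_equality)
    show "int F \<notin> int ` S" using S by auto
    fix z assume z: "z \<notin> int ` S"
    show "z \<le> int F"
    proof (rule ccontr)
      assume "\<not> z \<le> int F"
      then have "nat z \<in> S" "z = int (nat z)" using S by auto
      with z show False by (metis imageI)
    qed
  qed
qed

text \<open>Turns membership into elementwise conditions; the complement is finite because it lies
  in \<open>{..F}\<close>.\<close>

lemma mem_semigroups_frob_iff:
  "S \<in> semigroups_frob F \<longleftrightarrow>
     0 \<in> S \<and> (\<forall>x\<in>S. \<forall>y\<in>S. x + y \<in> S) \<and> F \<notin> S \<and> {F<..} \<subseteq> S"
proof -
  have "finite (- S)" if "{F<..} \<subseteq> S"
  proof (rule finite_subset)
    show "- S \<subseteq> - {F<..}" using that by blast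
  qed simp
  then show ?thesis
    using frobenius_number_eq_iff[of S F]
    by (auto simp: semigroups_frob_def numerical_semigroup_def)
qed

text \<open>A member is determined by its part in \<open>{..F}\<close>. Finiteness is what puts
  every member below a maximal one.\<close>

lemma finite_semigroups_frob: "finite (semigroups_frob F)"
proof (rule finite_subset)
  show "semigroups_frob F \<subseteq> (\<lambda>X. X \<union> {F<..}) ` Pow {..F}"
  proof
    fix S assume "S \<in> semigroups_frob F"
    then have "S = (S \<inter> {..F}) \<union> {F<..}" by (auto simp: mem_semigroups_frob_iff)
    then show "S \<in> (\<lambda>X. X \<union> {F<..}) ` Pow {..F}" by blast
  qed
qed simp

lemma ex_maximal_frob:
  assumes "S \<in> semigroups_frob F"
  obtains M where "maximal_frob F M" "S \<subseteq> M"
  using finite_has_maximal2[OF finite_semigroups_frob assms]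
  by (metis maximal_frob_def)

text \<open>The witness is \<open>S - frob_min F\<close>: every member contains
  \<open>frob_min F\<close>, so a member containing the witness contains \<open>S\<close>. This
  makes the \<open>LEAST\<close> in \<open>frob_rank\<close> an attained value.\<close>

lemma ex_frob_set_closure:
  assumes "S \<in> semigroups_frob F"
  obtains A where "frob_set F A" "frob_closure F A = S"
proof
  obtain M where "maximal_frob F M" "S \<subseteq> M" using ex_maximal_frob[OF assms] .
  then show "frob_set F (S - frob_min F)" by (auto simp: frob_set_def)
  have "S \<subseteq> T" if "T \<in> semigroups_frob F" "S - frob_min F \<subseteq> T" for T
  proof -
    have "frob_min F \<subseteq> T"
      using that(1) by (auto simp: mem_semigroups_frob_iff frob_min_def)
    with that(2) show ?thesis by blast
  qed
  with assms show "frob_closure F (S - frob_min F) = S"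
    unfolding frob_closure_def by blast
qed

lemma frob_rank_attained:
  assumes "S \<in> semigroups_frob F"
  obtains A where "frob_set F A" "frob_closure F A = S" "card A = frob_rank F S"
proof -
  have "\<exists>k A. frob_set F A \<and> frob_closure F A = S \<and> card A = k"
    using ex_frob_set_closure[OF assms] by metis
  from LeastI_ex[OF this] show thesis
    using that unfolding frob_rank_def by blast
qed

lemma mult_mem_semigroups_frob:
  assumes "S \<in> semigroups_frob F" "a \<in> S"
  shows "k * a \<in> S"
  using assms by (induction k) (auto simp: mem_semigroups_frob_iff)

text \<open>The right-hand side is closed under addition, since a sum with a term above
  \<open>F\<close> stays above \<open>F\<close>, and it omits \<open>F\<close> because
  \<open>a\<close> does not divide \<open>F\<close>. Any member containing \<open>a\<close> contains
  all its multiples.\<close>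

lemma frob_closure_singleton:
  assumes "\<not> a dvd F"
  shows "frob_closure F {a} = {z. a dvd z} \<union> {F<..}"
proof -
  let ?T = "{z. a dvd z} \<union> {F<..}"
  have "?T \<in> semigroups_frob F"
    using assms by (auto simp: mem_semigroups_frob_iff)
  moreover have "?T \<subseteq> U" if "U \<in> semigroups_frob F" "a \<in> U" for U
    using mult_mem_semigroups_frob[OF that] that(1)
    by (auto simp: mem_semigroups_frob_iff dvd_def mult.commute)
  moreover have "a \<in> ?T" by simp
  ultimately show ?thesis
    unfolding frob_closure_def by blast
qed

lemma multiplicity_multiples_Un:
  assumes "0 < a" "a \<le> F"
  shows "multiplicity ({z. a dvd z} \<union> {F<..}) = a"
  unfolding multiplicity_def
  using assms by (intro Least_equality) (auto dest: dvd_imp_le)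

lemma genus_multiples_Un:
  assumes "0 < a"
  shows "genus ({z. a dvd z} \<union> {F<..}) = F - F div a"
proof -
  have compl: "- ({z. a dvd z} \<union> {F<..}) = {1..F} - (\<lambda>k. k * a) ` {1..F div a}"
  proof (intro set_eqI iffI)
    fix z assume "z \<in> - ({z. a dvd z} \<union> {F<..})"
    then show "z \<in> {1..F} - (\<lambda>k. k * a) ` {1..F div a}"
      by (cases "z = 0") auto
  next
    fix z assume z: "z \<in> {1..F} - (\<lambda>k. k * a) ` {1..F div a}"
    have False if "a dvd z"
    proof -
      from that obtain k where k: "z = k * a" by (auto simp: dvd_def mult.commute)
      \<comment> \<open>As \<open>0 < a\<close>, the bound \<open>k * a \<le> F\<close> is
        equivalent to \<open>k \<le> F div a\<close>; \<open>k\<close> is positive because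
        \<open>z\<close> is.\<close>
      with z assms have "k \<in> {1..F div a}"
        by (auto simp: less_eq_div_iff_mult_less_eq Suc_le_eq)
      with z k show False by blast
    qed
    with z show "z \<in> - ({z. a dvd z} \<union> {F<..})" by auto
  qed
  have sub: "(\<lambda>k. k * a) ` {1..F div a} \<subseteq> {1..F}"
    using assms by (auto simp: less_eq_div_iff_mult_less_eq Suc_le_eq)
  have "inj_on (\<lambda>k. k * a) {1..F div a}"
    using assms by (auto simp: inj_on_def)
  then have "card ((\<lambda>k. k * a) ` {1..F div a}) = F div a"
    by (simp add: card_image)
  with sub show ?thesis
    unfolding genus_def compl by (simp add: card_Diff_subset)
qed

theorem proposition6p7:
  fixes F :: nat and S :: "nat set"
  assumes "F \<noteq> 0"
    and "S \<in> semigroups_frob F"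
    and "frob_rank F S = 1"
  shows "int (genus S) = int F - \<lfloor>real F / real (multiplicity S)\<rfloor>"
proof -
  obtain A where A: "frob_set F A" "frob_closure F A = S" "card A = 1"
    using frob_rank_attained[OF assms(2)] assms(3) by metis
  then obtain a where a: "A = {a}" by (auto simp: card_1_singleton_iff)
  with A obtain M where M: "M \<in> semigroups_frob F" "a \<in> M" "0 < a" "a \<le> F"
    by (auto simp: frob_set_def frob_min_def maximal_frob_def)
  \<comment> \<open>Otherwise \<open>F\<close> would be a multiple of \<open>a\<close> and hence lie
    in \<open>M\<close>.\<close>
  have "\<not> a dvd F"
    using mult_mem_semigroups_frob[OF M(1,2)] M(1)
    by (auto simp: mem_semigroups_frob_iff dvd_def mult.commute)
  then have S: "S = {z. a dvd z} \<union> {F<..}"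
    using A(2) a frob_closure_singleton by simp
  \<comment> \<open>The subtraction on naturals is exact here, since
    \<open>F div a \<le> F\<close>.\<close>
  have "int (genus S) = int F - int (F div a)"
    using genus_multiples_Un[OF M(3), of F] S by simp
  moreover have "multiplicity S = a"
    using multiplicity_multiples_Un[OF M(3,4)] S by simp
  ultimately show ?thesis
    by (simp add: floor_divide_of_nat_eq)
qed

end
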